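(* Let $D\subseteq\mathbb{R}$, let $f:D\to\mathbb{R}$, let $C=[(\underline{c}_L,\overline{c}_L),(\underline{c}_U,\overline{c}_U)]\in I_2(\mathbb{R})$, and let $F_2:D\to I_2(\mathbb{R})$, $F_2(x)=C f(x)$, be a bounded Type-2 interval-valued function. Let $x_o\in D$. If $f$ is differentiable at $x_o$ and has the same sign throughout $D$ (that is, $f\ge0$ on $D$ or $f\le0$ on $D$), then $F_2$ is gH-differentiable at $x_o$ and $$F_2'(x_o)=C f'(x_o).$$
   Context: A Type-2 interval is given by four real numbers $\underline{a}_L\le\overline{a}_L\le\underline{a}_U\le\overline{a}_U$ and is written $A=[(\underline{a}_L,\overline{a}_L),(\underline{a}_U,\overline{a}_U)]$; $I_2(\mathbb{R})$ denotes the set of all Type-2 intervals, with equality meaning equality of the four corresponding entries. Addition is entrywise: $A+B=[(\underline{a}_L+\underline{b}_L,\overline{a}_L+\overline{b}_L),(\underline{a}_U+\underline{b}_U,\overline{a}_U+\overline{b}_U)]$. For $\lambda\in\mathbb{R}$, the scalar multiple $\lambda A=A\lambda$ is $[(\lambda\underline{a}_L,\lambda\overline{a}_L),(\lambda\underline{a}_U,\lambda\overline{a}_U)]$ if $\lambda\ge0$ and $[(\lambda\overline{a}_U,\lambda\underline{a}_U),(\lambda\overline{a}_L,\lambda\underline{a}_L)]$ if $\lambda<0$; $A/h$ means $(1/h)A$ for real $h\ne0$. The generalised Hukuhara difference is defined by: $A\ominus_{gH} B=C$ if and only if (a) $A=B+C$ or (b) $B=A+(-1)C$. The extended Moore distance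 is $$D_{M_2}(X,Y)=\max\{|\underline{x}_L-\underline{y}_L|,\ |\overline{x}_L-\overline{y}_L|,\ |\underline{x}_U-\underline{y}_U|,\ |\overline{x}_U-\overline{y}_U|\};$$ limits of $I_2(\mathbb{R})$-valued functions of a real variable, and boundedness, are understood in this metric. A function $F_2:D\to I_2(\mathbb{R})$ is gH-differentiable at $x_o\in D$ if the limit $$F_2'(x_o)=\lim_{h\to0}\frac{F_2(x_o+h)\ominus_{gH}F_2(x_o)}{h}$$ exists in $I_2(\mathbb{R})$, where $h$ is such that $x_o+h\in D$. *)

theory Defs
  imports "HOL-Analysis.Analysis"
begin

text \<open>A Type-2 interval \<open>[(aL, bL), (aU, bU)]\<close> is the quadruple \<open>(aL, bL, aU, bU)\<close>; the letter
  a marks the underlined (lower) entry and b the overlined (upper) entry of each pair.\<close>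

typedef t2interval =
  "{(aL, bL, aU, bU). aL \<le> bL \<and> bL \<le> aU \<and> aU \<le> bU} :: (real \<times> real \<times> real \<times> real) set"
  by (rule exI[of _ "(0, 0, 0, 0)"]) simp

setup_lifting type_definition_t2interval

lift_definition lower_L :: "t2interval \<Rightarrow> real" is "\<lambda>(aL, bL, aU, bU). aL" .
lift_definition upper_L :: "t2interval \<Rightarrow> real" is "\<lambda>(aL, bL, aU, bU). bL" .
lift_definition lower_U :: "t2interval \<Rightarrow> real" is "\<lambda>(aL, bL, aU, bU). aU" .
lift_definition upper_U :: "t2interval \<Rightarrow> real" is "\<lambda>(aL, bL, aU, bU). bU" .

lemma t2interval_eq_iff:
  "A = B \<longleftrightarrow> lower_L A = lower_L B \<and> upper_L A = upper_L B \<and> lower_U A = lower_U B \<and> upper_U A = upper_U B"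
  by transfer auto

lemma t2interval_ordered: "lower_L A \<le> upper_L A" "upper_L A \<le> lower_U A" "lower_U A \<le> upper_U A"
  by (transfer, auto)+

text \<open>Only the syntactic classes for addition and scalar multiplication are instantiated:
  Type-2 intervals do not form a vector space.\<close>

instantiation t2interval :: "{plus, scaleR}"
begin

lift_definition plus_t2interval :: "t2interval \<Rightarrow> t2interval \<Rightarrow> t2interval"
  is "\<lambda>(aL, bL, aU, bU) (aL', bL', aU', bU'). (aL + aL', bL + bL', aU + aU', bU + bU')"
  by auto

lift_definition scaleR_t2interval :: "real \<Rightarrow> t2interval \<Rightarrow> t2interval"
  is "\<lambda>c (aL, bL, aU, bU). if c \<ge> 0 then (c * aL, c * bL, c * aU, c * bU)
                           else (c * bU, c * aU, c * bL, c * aL)"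
  by (auto intro: mult_left_mono mult_left_mono_neg split: if_splits)

instance ..

end

lemma plus_t2interval_sel [simp]:
  "lower_L (A + B) = lower_L A + lower_L B" "upper_L (A + B) = upper_L A + upper_L B"
  "lower_U (A + B) = lower_U A + lower_U B" "upper_U (A + B) = upper_U A + upper_U B"
  by (transfer, auto)+

lemma scaleR_t2interval_sel:
  fixes A :: t2interval
  shows "lower_L (c *\<^sub>R A) = (if c \<ge> 0 then c * lower_L A else c * upper_U A)"
    "upper_L (c *\<^sub>R A) = (if c \<ge> 0 then c * upper_L A else c * lower_U A)"
    "lower_U (c *\<^sub>R A) = (if c \<ge> 0 then c * lower_U A else c * upper_L A)"
    "upper_U (c *\<^sub>R A) = (if c \<ge> 0 then c * upper_U A else c * lower_L A)"
  by (transfer, auto split: if_splits)+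

text \<open>The metric is the extended Moore distance.\<close>

instantiation t2interval :: metric_space
begin

definition dist_t2interval :: "t2interval \<Rightarrow> t2interval \<Rightarrow> real" where
  "dist_t2interval X Y = Max {\<bar>lower_L X - lower_L Y\<bar>, \<bar>upper_L X - upper_L Y\<bar>,
                              \<bar>lower_U X - lower_U Y\<bar>, \<bar>upper_U X - upper_U Y\<bar>}"

definition uniformity_t2interval :: "(t2interval \<times> t2interval) filter" where
  "uniformity_t2interval = (INF e\<in>{0<..}. principal {(x, y). dist x y < e})"

definition open_t2interval :: "t2interval set \<Rightarrow> bool" where
  "open_t2interval U \<longleftrightarrow> (\<forall>x\<in>U. eventually (\<lambda>(x', y). x' = x \<longrightarrow> y \<in> U) uniformity)"

instance
proof
  fix x y z :: t2interval
  show "dist x y = 0 \<longleftrightarrow> x = y"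
    unfolding dist_t2interval_def t2interval_eq_iff by (auto simp: max_def)
  show "dist x y \<le> dist x z + dist y z"
  proof -
    have le: "dist a b \<le> e \<longleftrightarrow> \<bar>lower_L a - lower_L b\<bar> \<le> e \<and> \<bar>upper_L a - upper_L b\<bar> \<le> e \<and>
                \<bar>lower_U a - lower_U b\<bar> \<le> e \<and> \<bar>upper_U a - upper_U b\<bar> \<le> e" for a b :: t2interval and e
      unfolding dist_t2interval_def by simp
    have tri: "\<bar>a - b\<bar> \<le> d + e" if "\<bar>a - c\<bar> \<le> d" "\<bar>b - c\<bar> \<le> e" for a b c d e :: real
      using that by linarith
    show ?thesis
      using iffD1[OF le order_refl[of "dist x z"]] iffD1[OF le order_refl[of "dist y z"]]
      by (intro iffD2[OF le] conjI) (elim conjE, erule (1) tri)+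
  qed
qed (simp_all add: uniformity_t2interval_def open_t2interval_def)

end

text \<open>The generalised Hukuhara difference is a partial operation: \<open>is_gH_diff A B C\<close> is its defining
  relation, and \<open>gH_diff A B\<close> is meaningful when \<open>has_gH_diff A B\<close> holds.\<close>

definition is_gH_diff :: "t2interval \<Rightarrow> t2interval \<Rightarrow> t2interval \<Rightarrow> bool" where
  "is_gH_diff A B C \<longleftrightarrow> A = B + C \<or> B = A + (- 1) *\<^sub>R C"

definition has_gH_diff :: "t2interval \<Rightarrow> t2interval \<Rightarrow> bool" where
  "has_gH_diff A B \<longleftrightarrow> (\<exists>C. is_gH_diff A B C)"

definition gH_diff :: "t2interval \<Rightarrow> t2interval \<Rightarrow> t2interval" (infixl "\<ominus>\<^sub>g\<^sub>H" 65) where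
  "A \<ominus>\<^sub>g\<^sub>H B = (THE C. is_gH_diff A B C)"

lemma is_gH_diff_unique:
  assumes "is_gH_diff A B C" "is_gH_diff A B C'"
  shows "C = C'"
  using assms t2interval_ordered[of C] t2interval_ordered[of C']
  unfolding is_gH_diff_def t2interval_eq_iff
  by (auto simp: scaleR_t2interval_sel)

lemma gH_diff_eq_iff: "has_gH_diff A B \<Longrightarrow> A \<ominus>\<^sub>g\<^sub>H B = C \<longleftrightarrow> A = B + C \<or> B = A + (- 1) *\<^sub>R C"
  unfolding has_gH_diff_def gH_diff_def
  by (metis is_gH_diff_def is_gH_diff_unique the_equality)

text \<open>The limit defining the gH-derivative is a limit of a partial function, so the differences must
  exist for all small increments. As with \<^const>\<open>has_field_derivative\<close>, at an isolated point of \<open>D\<close>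
  the filter is trivial and the derivative is not unique.\<close>

definition gH_quotient :: "(real \<Rightarrow> t2interval) \<Rightarrow> real \<Rightarrow> real \<Rightarrow> t2interval" where
  "gH_quotient F x h = (1 / h) *\<^sub>R (F (x + h) \<ominus>\<^sub>g\<^sub>H F x)"

definition has_gH_derivative :: "(real \<Rightarrow> t2interval) \<Rightarrow> t2interval \<Rightarrow> real \<Rightarrow> real set \<Rightarrow> bool" where
  "has_gH_derivative F L x D \<longleftrightarrow>
     (\<forall>\<^sub>F h in at 0 within {h. x + h \<in> D}. has_gH_diff (F (x + h)) (F x)) \<and>
     (gH_quotient F x \<longlongrightarrow> L) (at 0 within {h. x + h \<in> D})"

definition gH_differentiable :: "(real \<Rightarrow> t2interval) \<Rightarrow> real \<Rightarrow> real set \<Rightarrow> bool" where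
  "gH_differentiable F x D \<longleftrightarrow> (\<exists>L. has_gH_derivative F L x D)"

definition gH_deriv :: "(real \<Rightarrow> t2interval) \<Rightarrow> real \<Rightarrow> real set \<Rightarrow> t2interval" where
  "gH_deriv F x D = Lim (at 0 within {h. x + h \<in> D}) (gH_quotient F x)"

end

theory Submission
  imports Defs
begin

text \<open>If \<open>a\<close> and \<open>b\<close> have the same sign, then \<open>(a - b) C\<close> is the gH-difference of \<open>a C\<close> and \<open>b C\<close>:
  distributivity applies to \<open>a = b + (a - b)\<close> when \<open>b\<close> and \<open>a - b\<close> have the same sign, and to
  \<open>b = a + (b - a)\<close> otherwise. So the gH-quotient of \<open>C f\<close> is \<open>C\<close> times the ordinary difference
  quotient of \<open>f\<close>, and \<open>c \<mapsto> c C\<close> is continuous.\<close>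

text \<open>A negative scalar reverses the order of the four entries, and reversals compose like
  signs.\<close>

lemma scaleR_scaleR_t2interval: "a *\<^sub>R (b *\<^sub>R C) = (a * b) *\<^sub>R (C :: t2interval)"
  by (cases a "0 :: real" rule: linorder_cases; cases b "0 :: real" rule: linorder_cases)
    (simp_all add: t2interval_eq_iff scaleR_t2interval_sel zero_le_mult_iff)

text \<open>With matching signs, \<open>a\<close>, \<open>b\<close> and \<open>a + b\<close> use the
  same branch of scalar multiplication (both branches give 0 at scalar 0), so this is distributivity
  in each entry.\<close>

lemma scaleR_left_distrib_t2interval:
  fixes C :: t2interval
  assumes "a \<ge> 0 \<and> b \<ge> 0 \<or> a \<le> 0 \<and> b \<le> 0"
  shows "(a + b) *\<^sub>R C = a *\<^sub>R C + b *\<^sub>R C"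
  using assms
  by (cases a "0 :: real" rule: linorder_cases; cases b "0 :: real" rule: linorder_cases)
    (simp_all add: t2interval_eq_iff scaleR_t2interval_sel distrib_right)

lemma is_gH_diff_scaleR:
  assumes "a \<ge> 0 \<and> b \<ge> 0 \<or> a \<le> 0 \<and> b \<le> 0"
  shows "is_gH_diff (a *\<^sub>R C) (b *\<^sub>R C) ((a - b) *\<^sub>R C)"
proof (cases "b \<ge> 0 \<and> a - b \<ge> 0 \<or> b \<le> 0 \<and> a - b \<le> 0")
  case True
  then show ?thesis
    using scaleR_left_distrib_t2interval[of b "a - b" C] by (simp add: is_gH_diff_def)
next
  case False
  \<comment> \<open>Here \<open>a - b\<close> is nonzero with sign opposite to \<open>b\<close>, so
    \<open>b - a\<close> has the common sign of \<open>a\<close> and \<open>b\<close>.\<close>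
  with assms have "a \<ge> 0 \<and> b - a \<ge> 0 \<or> a \<le> 0 \<and> b - a \<le> 0"
    by auto
  then show ?thesis
    using scaleR_left_distrib_t2interval[of a "b - a" C]
    by (simp add: is_gH_diff_def scaleR_scaleR_t2interval)
qed

lemma gH_diff_eqI: "is_gH_diff A B C \<Longrightarrow> A \<ominus>\<^sub>g\<^sub>H B = C"
  unfolding gH_diff_def using is_gH_diff_unique by blast

text \<open>The Moore distance is the maximum of the four entry distances, so entrywise convergence
  suffices.\<close>

lemma tendsto_t2intervalI:
  assumes "((\<lambda>x. lower_L (g x)) \<longlongrightarrow> lower_L L) F" "((\<lambda>x. upper_L (g x)) \<longlongrightarrow> upper_L L) F"
    and "((\<lambda>x. lower_U (g x)) \<longlongrightarrow> lower_U L) F" "((\<lambda>x. upper_U (g x)) \<longlongrightarrow> upper_U L) F"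
  shows "(g \<longlongrightarrow> L) F"
proof (rule tendstoI)
  fix e :: real
  assume "e > 0"
  show "\<forall>\<^sub>F x in F. dist (g x) L < e"
    using assms[THEN tendstoD, OF \<open>e > 0\<close>]
    by eventually_elim (simp add: dist_t2interval_def dist_real_def)
qed

text \<open>Writing the entries of \<open>c C\<close> as minima and maxima removes the case distinction on the sign
  of \<open>c\<close>, so that the limit \<open>c = 0\<close> needs no special treatment.\<close>

lemma scaleR_t2interval_sel_min_max:
  fixes A :: t2interval
  shows "lower_L (c *\<^sub>R A) = min (c * lower_L A) (c * upper_U A)"
    and "upper_L (c *\<^sub>R A) = min (c * upper_L A) (c * lower_U A)"
    and "lower_U (c *\<^sub>R A) = max (c * upper_L A) (c * lower_U A)"
    and "upper_U (c *\<^sub>R A) = max (c * lower_L A) (c * upper_U A)"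
proof -
  have "lower_L A \<le> upper_U A" "upper_L A \<le> lower_U A"
    using t2interval_ordered[of A] by linarith+
  then have "c * lower_L A \<le> c * upper_U A \<and> c * upper_L A \<le> c * lower_U A" if "c \<ge> 0"
    using that by (simp add: mult_left_mono)
  moreover have "c * upper_U A \<le> c * lower_L A \<and> c * lower_U A \<le> c * upper_L A" if "\<not> c \<ge> 0"
    using that \<open>lower_L A \<le> upper_U A\<close> \<open>upper_L A \<le> lower_U A\<close> by (simp add: mult_left_mono_neg)
  ultimately show "lower_L (c *\<^sub>R A) = min (c * lower_L A) (c * upper_U A)"
    and "upper_L (c *\<^sub>R A) = min (c * upper_L A) (c * lower_U A)"
    and "lower_U (c *\<^sub>R A) = max (c * upper_L A) (c * lower_U A)"
    and "upper_U (c *\<^sub>R A) = max (c * lower_L A) (c * upper_U A)"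
    by (cases "c \<ge> 0"; simp add: scaleR_t2interval_sel min_absorb1 min_absorb2 max_absorb1 max_absorb2)+
qed

lemma tendsto_scaleR_left_t2interval:
  fixes C :: t2interval
  assumes "(g \<longlongrightarrow> l) F"
  shows "((\<lambda>x. g x *\<^sub>R C) \<longlongrightarrow> l *\<^sub>R C) F"
  by (rule tendsto_t2intervalI)
    (unfold scaleR_t2interval_sel_min_max, (intro tendsto_intros assms)+)

text \<open>The case \<open>h = 0\<close> is included: division by zero gives 0, and both sides are
  \<open>0 *\<^sub>R C\<close>.\<close>

lemma gH_quotient_scaleR:
  assumes "F (x + h) = f (x + h) *\<^sub>R C" "F x = f x *\<^sub>R C"
    and "f (x + h) \<ge> 0 \<and> f x \<ge> 0 \<or> f (x + h) \<le> 0 \<and> f x \<le> 0"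
  shows "gH_quotient F x h = ((f (x + h) - f x) / h) *\<^sub>R C"
  using gH_diff_eqI[OF is_gH_diff_scaleR[OF assms(3)], of C]
  by (simp add: gH_quotient_def assms(1,2) scaleR_scaleR_t2interval)

text \<open>Translates between the library derivative, a limit in \<open>y = x + h\<close>, and the
  gH-derivative, a limit in \<open>h\<close>.\<close>

lemma at_within_shift:
  fixes x :: real
  shows "at x within D = filtermap ((+) x) (at 0 within {h. x + h \<in> D})"
proof (rule filter_eqI)
  fix P :: "real \<Rightarrow> bool"
  have shift: "(\<forall>y. Q y) \<longleftrightarrow> (\<forall>h. Q (x + h))" for Q :: "real \<Rightarrow> bool"
    by (metis add.commute diff_add_cancel)
  have "(\<forall>y\<in>D. y \<noteq> x \<and> dist y x < d \<longrightarrow> P y) \<longleftrightarrow>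
      (\<forall>h\<in>{h. x + h \<in> D}. h \<noteq> 0 \<and> dist h 0 < d \<longrightarrow> P (x + h))" for d
    unfolding Ball_def by (subst shift) (simp add: dist_real_def)
  then show "eventually P (at x within D) \<longleftrightarrow>
      eventually P (filtermap ((+) x) (at 0 within {h. x + h \<in> D}))"
    by (simp add: eventually_filtermap eventually_at)
qed

theorem theorem6p8:
  fixes D :: "real set" and f :: "real \<Rightarrow> real" and C :: t2interval
    and F2 :: "real \<Rightarrow> t2interval" and x\<^sub>o f' :: real
  assumes "\<And>x. x \<in> D \<Longrightarrow> F2 x = f x *\<^sub>R C"
    and "bounded (F2 ` D)"
    and "x\<^sub>o \<in> D"
    and "(f has_real_derivative f') (at x\<^sub>o within D)"
    and "(\<forall>x\<in>D. f x \<ge> 0) \<or> (\<forall>x\<in>D. f x \<le> 0)"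
  shows "gH_differentiable F2 x\<^sub>o D \<and> has_gH_derivative F2 (f' *\<^sub>R C) x\<^sub>o D \<and>
         (x\<^sub>o islimpt D \<longrightarrow> gH_deriv F2 x\<^sub>o D = f' *\<^sub>R C)"
proof -
  let ?A = "at 0 within {h. x\<^sub>o + h \<in> D}"
  have sgn: "f (x\<^sub>o + h) \<ge> 0 \<and> f x\<^sub>o \<ge> 0 \<or> f (x\<^sub>o + h) \<le> 0 \<and> f x\<^sub>o \<le> 0" if "x\<^sub>o + h \<in> D" for h
    using assms(3,5) that by blast
  have in_D: "\<forall>\<^sub>F h in ?A. x\<^sub>o + h \<in> D"
    by (simp add: eventually_at_filter)
  have ex: "\<forall>\<^sub>F h in ?A. has_gH_diff (F2 (x\<^sub>o + h)) (F2 x\<^sub>o)"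
    using in_D
  proof eventually_elim
    case (elim h)
    show ?case
      using is_gH_diff_scaleR[OF sgn[OF elim], of C] assms(1)[OF elim] assms(1)[OF assms(3)]
      by (auto simp: has_gH_diff_def)
  qed
  have "((\<lambda>h. (f (x\<^sub>o + h) - f x\<^sub>o) / h) \<longlongrightarrow> f') ?A"
    using assms(4)[unfolded has_field_derivative_iff]
    by (simp add: at_within_shift[of x\<^sub>o D] filterlim_filtermap)
  then have "((\<lambda>h. ((f (x\<^sub>o + h) - f x\<^sub>o) / h) *\<^sub>R C) \<longlongrightarrow> f' *\<^sub>R C) ?A"
    by (rule tendsto_scaleR_left_t2interval)
  moreover have "\<forall>\<^sub>F h in ?A. ((f (x\<^sub>o + h) - f x\<^sub>o) / h) *\<^sub>R C = gH_quotient F2 x\<^sub>o h"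
    using in_D by eventually_elim (simp add: gH_quotient_scaleR[where f = f] assms(1,3) sgn)
  ultimately have lim: "(gH_quotient F2 x\<^sub>o \<longlongrightarrow> f' *\<^sub>R C) ?A"
    by (rule Lim_transform_eventually)
  have "gH_deriv F2 x\<^sub>o D = f' *\<^sub>R C" if "x\<^sub>o islimpt D"
  proof -
    \<comment> \<open>Limits are unique only along a nontrivial filter; the shift carries
      \<open>?A\<close> to \<open>at x\<^sub>o within D\<close>, which is nontrivial at a limit
      point.\<close>
    have "?A \<noteq> bot"
      using that trivial_limit_within[of x\<^sub>o D]
      by (simp add: at_within_shift[of x\<^sub>o D] filtermap_bot_iff)
    then show ?thesis
      unfolding gH_deriv_def using lim by (rule tendsto_Lim)
  qed
  with ex lim show ?thesis
    unfolding gH_differentiable_def has_gH_derivative_def by blast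
qed

end
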